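(* Let $\mathcal{A}\in\mathbb{C}^{n_1\times n_2\times n_3}$ and $\mathcal{G}\in\mathbb{C}^{n_2\times n_1\times n_3}$. Suppose $\mathcal{G}=\mathcal{M}*_c\mathcal{N}$ is the C-full rank decomposition of $\mathcal{G}$. If $\mathcal{A}$ is invertible along $\mathcal{G}$, then $$\mathcal{A}^{\parallel\mathcal{G}}=\mathcal{M}*_c(\mathcal{N}*_c\mathcal{A}*_c\mathcal{M})^{-1}*_c\mathcal{N}.$$
   Context: For a third-order tensor $\mathcal{A}\in\mathbb{C}^{n_1\times n_2\times n_3}$, $\mathcal{A}^{(i)}=\mathcal{A}(:,:,i)\in\mathbb{C}^{n_1\times n_2}$ denotes its $i$-th frontal slice. Let $\mathbf{C}_{n_3}$ be the $n_3\times n_3$ orthogonal DCT matrix, with entries $(\mathbf{C}_{n_3})_{jk}=\sqrt{(2-\delta_{j1})/n_3}\,\cos\big(\tfrac{(j-1)(2k-1)\pi}{2n_3}\big)$; let $\mathbf{W}$ be the diagonal matrix whose diagonal is the first column of $\mathbf{C}_{n_3}$; let $\mathbf{Z}$ be the $n_3\times n_3$ matrix with ones on the first superdiagonal and zeros elsewhere; and put $\mathbf{M}=\mathbf{W}^{-1}\mathbf{C}_{n_3}(\mathbf{I}+\mathbf{Z})$, an invertible matrix. Define the linear bijection $L$ on tensors with third dimension $n_3$ by $L(\mathcal{A})_{ijk}=\sum_{l=1}^{n_3}\mathbf{M}_{kl}\mathcal{A}_{ijl}$. The C-product of $\mathcal{A}\in\mathbb{C}^{n_1\times n_2\times n_3}$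 and $\mathcal{B}\in\mathbb{C}^{n_2\times l\times n_3}$ is the tensor $\mathcal{A}*_c\mathcal{B}\in\mathbb{C}^{n_1\times l\times n_3}$ determined by $L(\mathcal{A}*_c\mathcal{B})^{(i)}=L(\mathcal{A})^{(i)}L(\mathcal{B})^{(i)}$, $i=1,\dots,n_3$. The conjugate transpose $\mathcal{A}^H$ is determined by $L(\mathcal{A}^H)^{(i)}=(L(\mathcal{A})^{(i)})^H$ for all $i$. The identity tensor $\mathcal{I}\in\mathbb{C}^{n\times n\times n_3}$ is determined by $L(\mathcal{I})^{(i)}=\mathbf{I}_n$ for all $i$. The inverse $\mathcal{B}^{-1}$ of $\mathcal{B}\in\mathbb{C}^{n\times n\times n_3}$ is the tensor with $\mathcal{B}*_c\mathcal{B}^{-1}=\mathcal{B}^{-1}*_c\mathcal{B}=\mathcal{I}$; a formula containing an inverse includes the assertion that the inverse exists. A C-full rank decomposition of $\mathcal{G}\in\mathbb{C}^{n_2\times n_1\times n_3}$ is a factorization $\mathcal{G}=\mathcal{M}*_c\mathcal{N}$ with $\mathcal{M}\in\mathbb{C}^{n_2\times r\times n_3}$, $\mathcal{N}\in\mathbb{C}^{r\times n_1\times n_3}$ (for some $r$) such that, for every $i=1,\dots,n_3$, $L(\mathcal{M})^{(i)}\in\mathbb{C}^{n_2\times r}$ and $L(\mathcal{N})^{(i)}\in\mathbb{C}^{r\times n_1}$ both have rank $r$. Let $\mathcal{A}\in\mathbb{C}^{n_1\times n_2\times n_3}$ and $\mathcal{G}\in\mathbb{C}^{n_2\times n_1\times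 n_3}$. $\mathcal{A}$ is invertible along $\mathcal{G}$ if there exist $\mathcal{X}\in\mathbb{C}^{n_2\times n_1\times n_3}$, $\mathcal{U}\in\mathbb{C}^{n_1\times n_1\times n_3}$ and $\mathcal{V}\in\mathbb{C}^{n_2\times n_2\times n_3}$ such that $\mathcal{X}*_c\mathcal{A}*_c\mathcal{G}=\mathcal{G}$, $\mathcal{G}*_c\mathcal{A}*_c\mathcal{X}=\mathcal{G}$, $\mathcal{X}=\mathcal{G}*_c\mathcal{U}$ and $\mathcal{X}^H=\mathcal{G}^H*_c\mathcal{V}$; such an $\mathcal{X}$ is unique, is called the inverse of $\mathcal{A}$ along $\mathcal{G}$, and is denoted $\mathcal{A}^{\parallel\mathcal{G}}$. *)

theory Defs
  imports
    "Jordan_Normal_Form.Gauss_Jordan_Elimination"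
    "Jordan_Normal_Form.Schur_Decomposition"
    "Jordan_Normal_Form.DL_Rank"
begin

text \<open>
  A third-order tensor is the vector of its frontal slices: the entry with (1-based) indices
  \<open>(i, j, k)\<close> is \<open>A $ (k-1) $$ (i-1, j-1)\<close>. All indices below are 0-based.
\<close>

type_synonym tensor = "complex mat vec"

definition carrier_tensor :: "nat \<Rightarrow> nat \<Rightarrow> nat \<Rightarrow> tensor set" where
  "carrier_tensor n1 n2 n3 =
     {A. dim_vec A = n3 \<and> (\<forall>k<n3. A $ k \<in> carrier_mat n1 n2)}"

text \<open>
  The first two dimensions are read off slice 0, so they are meaningful only if the third
  dimension is positive.
\<close>

definition trows :: "tensor \<Rightarrow> nat" where
  "trows A = dim_row (A $ 0)"

definition tcols :: "tensor \<Rightarrow> nat" where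
  "tcols A = dim_col (A $ 0)"

text \<open>Orthogonal DCT matrix; 1-based \<open>j - 1\<close> and \<open>2k - 1\<close> become 0-based \<open>j\<close> and \<open>2k + 1\<close>.\<close>

definition dct_mat :: "nat \<Rightarrow> complex mat" where
  "dct_mat n = mat n n (\<lambda>(j, k). complex_of_real
     (sqrt ((2 - (if j = 0 then 1 else 0)) / real n)
        * cos (real j * (2 * real k + 1) * pi / (2 * real n))))"

definition W_mat :: "nat \<Rightarrow> complex mat" where
  "W_mat n = mat_diag n (\<lambda>j. dct_mat n $$ (j, 0))"

definition Z_mat :: "nat \<Rightarrow> complex mat" where
  "Z_mat n = mat n n (\<lambda>(i, j). if j = i + 1 then 1 else 0)"

definition M_mat :: "nat \<Rightarrow> complex mat" where
  "M_mat n = the (mat_inverse (W_mat n)) * dct_mat n * (1\<^sub>m n + Z_mat n)"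

definition L :: "tensor \<Rightarrow> tensor" where
  "L A = vec (dim_vec A) (\<lambda>k. mat (trows A) (tcols A)
     (\<lambda>(i, j). \<Sum>l<dim_vec A. M_mat (dim_vec A) $$ (k, l) * A $ l $$ (i, j)))"

text \<open>
  The next three definitions rely on \<open>L\<close> being a bijection of each
  \<open>carrier_tensor n1 n2 n3\<close> with \<open>n3 > 0\<close>.
\<close>

definition c_prod :: "tensor \<Rightarrow> tensor \<Rightarrow> tensor" (infixl \<open>*\<^sub>c\<close> 70) where
  "A *\<^sub>c B = (THE C. C \<in> carrier_tensor (trows A) (tcols B) (dim_vec A) \<and>
     (\<forall>i<dim_vec A. L C $ i = L A $ i * L B $ i))"

definition c_adjoint :: "tensor \<Rightarrow> tensor" where
  "c_adjoint A = (THE B. B \<in> carrier_tensor (tcols A) (trows A) (dim_vec A) \<and>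
     (\<forall>i<dim_vec A. L B $ i = mat_adjoint (L A $ i)))"

definition c_identity :: "nat \<Rightarrow> nat \<Rightarrow> tensor" where
  "c_identity n n3 = (THE J. J \<in> carrier_tensor n n n3 \<and> (\<forall>i<n3. L J $ i = 1\<^sub>m n))"

definition is_c_inverse :: "tensor \<Rightarrow> tensor \<Rightarrow> bool" where
  "is_c_inverse B X \<longleftrightarrow>
     B \<in> carrier_tensor (trows B) (trows B) (dim_vec B) \<and>
     X \<in> carrier_tensor (trows B) (trows B) (dim_vec B) \<and>
     B *\<^sub>c X = c_identity (trows B) (dim_vec B) \<and>
     X *\<^sub>c B = c_identity (trows B) (dim_vec B)"

definition c_invertible :: "tensor \<Rightarrow> bool" where
  "c_invertible B \<longleftrightarrow> (\<exists>X. is_c_inverse B X)"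

definition c_inverse :: "tensor \<Rightarrow> tensor" where
  "c_inverse B = (THE X. is_c_inverse B X)"

text \<open>\<open>vec_space.rank m\<close> is the column rank of a matrix with \<open>m\<close> rows; \<open>r = 0\<close> is allowed.\<close>

definition c_full_rank_decomposition :: "tensor \<Rightarrow> tensor \<Rightarrow> tensor \<Rightarrow> bool" where
  "c_full_rank_decomposition G M N \<longleftrightarrow> G = M *\<^sub>c N \<and>
     (\<exists>r. M \<in> carrier_tensor (trows G) r (dim_vec G) \<and>
          N \<in> carrier_tensor r (tcols G) (dim_vec G) \<and>
          (\<forall>i<dim_vec G. vec_space.rank (trows G) (L M $ i) = r \<and>
                         vec_space.rank r (L N $ i) = r))"

definition is_inverse_along :: "tensor \<Rightarrow> tensor \<Rightarrow> tensor \<Rightarrow> bool" where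
  "is_inverse_along A G X \<longleftrightarrow>
     X \<in> carrier_tensor (tcols A) (trows A) (dim_vec A) \<and>
     (\<exists>U \<in> carrier_tensor (trows A) (trows A) (dim_vec A).
      \<exists>V \<in> carrier_tensor (tcols A) (tcols A) (dim_vec A).
        X *\<^sub>c A *\<^sub>c G = G \<and> G *\<^sub>c A *\<^sub>c X = G \<and>
        X = G *\<^sub>c U \<and> c_adjoint X = c_adjoint G *\<^sub>c V)"

definition invertible_along :: "tensor \<Rightarrow> tensor \<Rightarrow> bool" where
  "invertible_along A G \<longleftrightarrow> (\<exists>X. is_inverse_along A G X)"

definition inverse_along :: "tensor \<Rightarrow> tensor \<Rightarrow> tensor" where
  "inverse_along A G = (THE X. is_inverse_along A G X)"

end

theory Submission
  imports Defs
begin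

text \<open>
  Since \<open>M_mat p\<close> is invertible for \<open>p > 0\<close>, \<open>L\<close> is a bijection of every \<open>carrier_tensor n m p\<close>, and it
  turns the C-product, the adjoint and the identity into slicewise matrix operations. Tensors
  therefore obey the matrix laws (\<open>c_prod_assoc\<close>, \<open>c_adjoint_eq_prodD\<close>,
  \<open>c_right_inverse_imp_left_inverse\<close>), and full rank of every slice makes \<open>M\<close> left cancellable
  (\<open>c_prod_left_cancel\<close>) and gives \<open>N\<close> a right inverse \<open>R\<close> (\<open>c_right_inverse_exists\<close>).

  Let \<open>X = G U\<close> be an inverse of \<open>A\<close> along \<open>G = M N\<close>, and put \<open>T = N A M\<close>. The equation \<open>G A X = G\<close>
  reads \<open>M (T (N U)) = M N\<close>, so \<open>T (N U) = N\<close> after cancelling \<open>M\<close>. Multiplying by \<open>R\<close> gives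
  \<open>T (N U R) = I\<close>; as \<open>T\<close> is square, it is invertible. Then \<open>N U = T\<inverse> N\<close>, and
  \<open>X = M (N U) = M T\<inverse> N\<close>. Because an inverse along \<open>G\<close> is unique (\<open>is_inverse_along_unique\<close>), this
  \<open>X\<close> is \<open>inverse_along A G\<close>.
\<close>

section \<open>Orthogonality of the cosine transform\<close>

text \<open>
  With \<open>a = m \<pi> / (2 n)\<close> the sum becomes telescoping after multiplication by \<open>2 sin a\<close>, and it
  collapses to \<open>sin (m \<pi>) = 0\<close>. The bound on \<open>m\<close> keeps \<open>sin a\<close> from vanishing.
\<close>

lemma sum_cos_odd_multiples:
  fixes m :: real
  assumes m: "m \<in> \<int>" and nz: "m \<noteq> 0" and small: "\<bar>m\<bar> < 2 * real n"
  shows "(\<Sum>k<n. cos (m * (2 * real k + 1) * pi / (2 * real n))) = 0"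
proof -
  have n: "0 < n" using nz small by (cases n) auto
  define a where "a = m * pi / (2 * real n)"
  have step: "2 * sin a * cos (m * (2 * real k + 1) * pi / (2 * real n))
      = sin (2 * real (Suc k) * a) - sin (2 * real k * a)" for k
  proof -
    have "m * (2 * real k + 1) * pi / (2 * real n) = (2 * real k + 1) * a"
      by (simp add: a_def)
    moreover have "2 * real (Suc k) * a = (2 * real k + 1) * a + a"
      and "2 * real k * a = (2 * real k + 1) * a - a"
      by (simp_all add: algebra_simps)
    moreover have "2 * sin a * cos b = sin (b + a) - sin (b - a)" for b
      by (simp add: sin_add sin_diff)
    ultimately show ?thesis by (simp only:)
  qed
  have "2 * sin a * (\<Sum>k<n. cos (m * (2 * real k + 1) * pi / (2 * real n)))
      = (\<Sum>k<n. sin (2 * real (Suc k) * a) - sin (2 * real k * a))"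
    by (simp only: sum_distrib_left step)
  also have "\<dots> = sin (2 * real n * a)"
    by (subst sum_lessThan_telescope) simp
  also have "2 * real n * a = m * pi"
    using n by (simp add: a_def)
  also have "sin (m * pi) = 0"
    using m by (metis sin_zero_iff_int2 Ints_cases)
  finally have "2 * sin a * (\<Sum>k<n. cos (m * (2 * real k + 1) * pi / (2 * real n))) = 0" .
  moreover have "sin a \<noteq> 0"
  proof
    assume "sin a = 0"
    then obtain i :: int where "a = of_int i * pi" by (auto simp: sin_zero_iff_int2)
    hence mi: "m = 2 * real n * of_int i" using n by (simp add: a_def field_simps)
    hence "i \<noteq> 0" using nz by auto
    hence "1 \<le> \<bar>real_of_int i\<bar>" by linarith
    hence "2 * real n * 1 \<le> 2 * real n * \<bar>real_of_int i\<bar>"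
      by (intro mult_left_mono) auto
    thus False using small mi by (simp add: abs_mult)
  qed
  ultimately show ?thesis by simp
qed

lemma sum_cos_cos_odd_multiples:
  assumes i: "i < n" and j: "j < n"
  shows "(\<Sum>k<n. cos (real i * (2 * real k + 1) * pi / (2 * real n))
               * cos (real j * (2 * real k + 1) * pi / (2 * real n)))
    = (if i = j then if i = 0 then real n else real n / 2 else 0)"
proof -
  define S where "S m = (\<Sum>k<n. cos (m * (2 * real k + 1) * pi / (2 * real n)))" for m :: real
  have "(\<Sum>k<n. cos (real i * (2 * real k + 1) * pi / (2 * real n))
               * cos (real j * (2 * real k + 1) * pi / (2 * real n)))
    = (S (real i - real j) + S (real i + real j)) / 2"
    unfolding S_def cos_times_cos sum.distrib[symmetric] sum_divide_distrib
    by (intro sum.cong refl arg_cong2[where f = "(/)"] arg_cong2[where f = "(+)"]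
        arg_cong[where f = cos])
       (simp_all add: add_divide_distrib diff_divide_distrib algebra_simps)
  moreover have "S 0 = real n" by (simp add: S_def)
  moreover have "S (real i - real j) = 0" if "i \<noteq> j"
    unfolding S_def using that i j by (intro sum_cos_odd_multiples) auto
  moreover have "S (real i + real j) = 0" if "i \<noteq> 0 \<or> j \<noteq> 0"
    unfolding S_def using that i j by (intro sum_cos_odd_multiples) auto
  ultimately show ?thesis by auto
qed

text \<open>
  The weights \<open>sqrt ((2 - \<delta>) / n)\<close> are what normalizes the squared row norms \<open>n\<close> and \<open>n / 2\<close> of the
  cosine matrix to 1.
\<close>

lemma dct_mat_orthogonal: "dct_mat n * transpose_mat (dct_mat n) = 1\<^sub>m n"
proof (rule eq_matI)
  fix i j assume "i < dim_row (1\<^sub>m n)" "j < dim_col (1\<^sub>m n)"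
  hence i: "i < n" and j: "j < n" by auto
  define w where "w h = sqrt ((2 - (if h = 0 then 1 else 0)) / real n)" for h :: nat
  have ww: "w h * w h = (if h = 0 then 1 else 2) / real n" for h
    by (simp add: w_def)
  have "(dct_mat n * transpose_mat (dct_mat n)) $$ (i, j) =
    of_real (w i * w j * (\<Sum>k<n. cos (real i * (2 * real k + 1) * pi / (2 * real n))
               * cos (real j * (2 * real k + 1) * pi / (2 * real n))))"
    using i j by (simp add: dct_mat_def scalar_prod_def w_def sum_distrib_left
        mult_ac atLeast0LessThan)
  also have "w i * w j * (\<Sum>k<n. cos (real i * (2 * real k + 1) * pi / (2 * real n))
               * cos (real j * (2 * real k + 1) * pi / (2 * real n))) = (if i = j then 1 else 0)"
    unfolding sum_cos_cos_odd_multiples[OF i j] using i by (auto simp: ww)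
  also have "complex_of_real (if i = j then 1 else 0) = 1\<^sub>m n $$ (i, j)"
    using i j by simp
  finally show "(dct_mat n * transpose_mat (dct_mat n)) $$ (i, j) = 1\<^sub>m n $$ (i, j)" .
qed (simp_all add: dct_mat_def)

section \<open>The transform L is bijective\<close>

text \<open>
  The diagonal entries are positive multiples of \<open>cos (i \<pi> / (2 n))\<close>, whose arguments lie in
  \<open>[0, \<pi>/2)\<close>.
\<close>

lemma det_W_mat: "0 < n \<Longrightarrow> det (W_mat n) \<noteq> 0"
proof -
  assume n: "0 < n"
  have "dct_mat n $$ (i, 0) \<noteq> 0" if i: "i < n" for i
  proof -
    have "cos (real i * pi / (2 * real n)) > 0"
      using i n by (intro cos_gt_zero_pi) (auto simp: field_simps intro: order.strict_trans2[of _ 0])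
    moreover have "sqrt ((2 - (if i = 0 then 1 else 0)) / real n) > 0"
      using n by auto
    ultimately have "sqrt ((2 - (if i = 0 then 1 else 0)) / real n)
        * cos (real i * pi / (2 * real n)) \<noteq> 0" by (metis mult_pos_pos less_irrefl)
    thus ?thesis using i n by (simp add: dct_mat_def)
  qed
  moreover have "upper_triangular (W_mat n)" "W_mat n \<in> carrier_mat n n"
    by (auto simp: W_mat_def mat_diag_def)
  ultimately show ?thesis
    by (subst det_upper_triangular) (auto simp: diag_mat_def W_mat_def mat_diag_def)
qed

text \<open>
  All three factors have nonzero determinant: \<open>I + Z\<close> is unit upper triangular, the DCT matrix has
  its transpose as inverse, and \<open>det (W_mat n) \<noteq> 0\<close> also makes \<open>mat_inverse\<close> return a proper inverse
  rather than \<open>None\<close>.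
\<close>

lemma M_mat_invertible:
  assumes n: "0 < n"
  shows "M_mat n \<in> carrier_mat n n \<and>
    (\<exists>P \<in> carrier_mat n n. P * M_mat n = 1\<^sub>m n \<and> M_mat n * P = 1\<^sub>m n)"
proof -
  have W: "W_mat n \<in> carrier_mat n n" by (simp add: W_mat_def)
  obtain B where B: "mat_inverse (W_mat n) = Some B"
    using mat_inverse(1)[OF W] det_non_zero_imp_unit[OF W det_W_mat[OF n]] by fastforce
  note WB = mat_inverse(2)[OF W B]
  have C: "dct_mat n \<in> carrier_mat n n" by (simp add: dct_mat_def)
  have Z: "1\<^sub>m n + Z_mat n \<in> carrier_mat n n" by (simp add: Z_mat_def)
  have "det B \<noteq> 0" "det (dct_mat n) \<noteq> 0"
    using det_mult[of "W_mat n" n B] det_mult[of "dct_mat n" n "transpose_mat (dct_mat n)"]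
      W WB C dct_mat_orthogonal[of n] by auto
  moreover have "det (1\<^sub>m n + Z_mat n) \<noteq> 0"
    by (subst det_upper_triangular[OF _ Z]) (auto simp: Z_mat_def diag_mat_def)
  moreover have Mc: "M_mat n \<in> carrier_mat n n"
    using WB C Z by (auto simp: M_mat_def B)
  ultimately have "det (M_mat n) \<noteq> 0"
    using WB C Z by (simp add: M_mat_def B det_mult[OF mult_carrier_mat[of B n n "dct_mat n" n] Z]
        det_mult[of B n "dct_mat n"])
  from det_non_zero_imp_unit[OF Mc this, of undefined] Mc show ?thesis
    by (auto simp: Units_def ring_mat_def)
qed

text \<open>Positivity of \<open>p\<close> is what lets the first two dimensions be read off slice 0.\<close>

lemma carrier_tensorD:
  assumes "A \<in> carrier_tensor n m p" and "0 < p"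
  shows "dim_vec A = p" "trows A = n" "tcols A = m" "k < p \<Longrightarrow> A $ k \<in> carrier_mat n m"
  using assms by (auto simp: carrier_tensor_def trows_def tcols_def)

lemma tensor_eqI:
  assumes "A \<in> carrier_tensor n m p" "B \<in> carrier_tensor n m p"
    and "\<And>k. k < p \<Longrightarrow> A $ k = B $ k"
  shows "A = B"
  using assms by (intro eq_vecI) (auto simp: carrier_tensor_def)

text \<open>
  The mode-3 product of a matrix and a tensor. Keeping the matrix arbitrary is what allows \<open>L\<close> to
  be inverted: the inverse of \<open>L\<close> is the mode-3 product with the inverse of \<open>M_mat p\<close>.
\<close>

definition mode3 :: "complex mat \<Rightarrow> tensor \<Rightarrow> tensor" where
  "mode3 P A = vec (dim_vec A) (\<lambda>k. mat (trows A) (tcols A)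
     (\<lambda>(i, j). \<Sum>l<dim_vec A. P $$ (k, l) * A $ l $$ (i, j)))"

lemma L_eq_mode3: "L A = mode3 (M_mat (dim_vec A)) A"
  by (simp add: L_def mode3_def)

lemma mode3_closed:
  assumes "A \<in> carrier_tensor n m p" and "0 < p"
  shows "mode3 P A \<in> carrier_tensor n m p"
  using carrier_tensorD[OF assms] by (auto simp: mode3_def carrier_tensor_def)

lemma mode3_one:
  assumes A: "A \<in> carrier_tensor n m p" and p: "0 < p"
  shows "mode3 (1\<^sub>m p) A = A"
proof (rule tensor_eqI[OF mode3_closed[OF A p] A])
  note [simp] = carrier_tensorD(1-3)[OF A p]
  fix k assume k: "k < p"
  show "mode3 (1\<^sub>m p) A $ k = A $ k"
  proof (rule eq_matI)
    fix i j assume "i < dim_row (A $ k)" "j < dim_col (A $ k)"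
    hence "i < n" "j < m" using carrier_tensorD(4)[OF A p k] by auto
    hence "(mode3 (1\<^sub>m p) A $ k) $$ (i, j) = (\<Sum>l<p. 1\<^sub>m p $$ (k, l) * A $ l $$ (i, j))"
      using k by (simp add: mode3_def)
    also have "\<dots> = (\<Sum>l<p. if l = k then A $ l $$ (i, j) else 0)"
      using k by (intro sum.cong) auto
    also have "\<dots> = A $ k $$ (i, j)" using k by simp
    finally show "(mode3 (1\<^sub>m p) A $ k) $$ (i, j) = A $ k $$ (i, j)" .
  qed (use k carrier_tensorD(4)[OF A p k] in \<open>auto simp: mode3_def\<close>)
qed

lemma mode3_mode3:
  assumes A: "A \<in> carrier_tensor n m p" and p: "0 < p"
    and P: "P \<in> carrier_mat p p" and Q: "Q \<in> carrier_mat p p"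
  shows "mode3 P (mode3 Q A) = mode3 (P * Q) A"
proof (rule tensor_eqI)
  note QA = mode3_closed[OF A p, of Q]
  note dA = carrier_tensorD(1-3)[OF A p] and dQA = carrier_tensorD(1-3)[OF QA p]
  show "mode3 P (mode3 Q A) \<in> carrier_tensor n m p" "mode3 (P * Q) A \<in> carrier_tensor n m p"
    by (intro mode3_closed A p)+
  fix k assume k: "k < p"
  show "mode3 P (mode3 Q A) $ k = mode3 (P * Q) A $ k"
  proof (rule eq_matI)
    fix i j
    assume "i < dim_row (mode3 (P * Q) A $ k)" "j < dim_col (mode3 (P * Q) A $ k)"
    hence i: "i < n" and j: "j < m" using k dA by (auto simp: mode3_def)
    have "(mode3 P (mode3 Q A) $ k) $$ (i, j)
        = (\<Sum>l<p. \<Sum>h<p. P $$ (k, l) * (Q $$ (l, h) * A $ h $$ (i, j)))"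
      unfolding mode3_def[of P] dQA using i j k
      by (auto simp: mode3_def dA sum_distrib_left intro!: sum.cong)
    also have "\<dots> = (\<Sum>h<p. \<Sum>l<p. P $$ (k, l) * (Q $$ (l, h) * A $ h $$ (i, j)))"
      by (rule sum.swap)
    also have "\<dots> = (mode3 (P * Q) A $ k) $$ (i, j)"
      using i j k P Q
      by (auto simp: mode3_def dA scalar_prod_def sum_distrib_right mult.assoc atLeast0LessThan
          intro!: sum.cong)
    finally show "(mode3 P (mode3 Q A) $ k) $$ (i, j) = (mode3 (P * Q) A $ k) $$ (i, j)" .
  qed (use k dA dQA in \<open>auto simp: mode3_def[of P] mode3_def[of "P * Q"]\<close>)
qed

lemma L_closed:
  assumes "A \<in> carrier_tensor n m p" and "0 < p"
  shows "L A \<in> carrier_tensor n m p"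
  unfolding L_eq_mode3 by (intro mode3_closed assms)

lemma L_slice_closed [intro]:
  assumes "A \<in> carrier_tensor n m p" and "k < p"
  shows "L A $ k \<in> carrier_mat n m"
  using carrier_tensorD(4)[OF L_closed] assms by auto

lemma L_inject:
  assumes A: "A \<in> carrier_tensor n m p" and B: "B \<in> carrier_tensor n m p" and p: "0 < p"
    and eq: "\<And>k. k < p \<Longrightarrow> L A $ k = L B $ k"
  shows "A = B"
proof -
  obtain P where P: "P \<in> carrier_mat p p" "P * M_mat p = 1\<^sub>m p" and M: "M_mat p \<in> carrier_mat p p"
    using M_mat_invertible[OF p] by auto
  have "mode3 P (L X) = X" if X: "X \<in> carrier_tensor n m p" for X
    using mode3_mode3[OF X p P(1) M] mode3_one[OF X p] carrier_tensorD(1)[OF X p] P(2)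
    by (simp add: L_eq_mode3)
  moreover have "L A = L B"
    by (rule tensor_eqI[OF L_closed[OF A p] L_closed[OF B p] eq])
  ultimately show ?thesis by (metis A B)
qed

lemma L_surj:
  assumes p: "0 < p" and F: "\<And>k. k < p \<Longrightarrow> F k \<in> carrier_mat n m"
  shows "\<exists>A \<in> carrier_tensor n m p. \<forall>k<p. L A $ k = F k"
proof -
  obtain P where P: "P \<in> carrier_mat p p" "M_mat p * P = 1\<^sub>m p" and M: "M_mat p \<in> carrier_mat p p"
    using M_mat_invertible[OF p] by auto
  define B where "B = vec p F"
  have B: "B \<in> carrier_tensor n m p" using F by (simp add: B_def carrier_tensor_def)
  have PB: "mode3 P B \<in> carrier_tensor n m p" by (rule mode3_closed[OF B p])
  have "L (mode3 P B) = B"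
    using mode3_mode3[OF B p M P(1)] mode3_one[OF B p] carrier_tensorD(1)[OF PB p] P(2)
    by (simp add: L_eq_mode3)
  thus ?thesis using PB by (intro bexI[of _ "mode3 P B"]) (simp_all add: B_def)
qed

text \<open>
  This is the fact that licenses the definite descriptions defining the C-product, the adjoint and
  the identity tensor.
\<close>

lemma L_ex1:
  assumes p: "0 < p" and F: "\<And>k. k < p \<Longrightarrow> F k \<in> carrier_mat n m"
  shows "\<exists>!A. A \<in> carrier_tensor n m p \<and> (\<forall>k<p. L A $ k = F k)"
proof -
  have "\<exists>A \<in> carrier_tensor n m p. \<forall>k<p. L A $ k = F k"
    by (rule L_surj[OF p]) (rule F)
  then obtain A where A: "A \<in> carrier_tensor n m p" "\<forall>k<p. L A $ k = F k" ..
  show ?thesis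
  proof (rule ex1I)
    show "A \<in> carrier_tensor n m p \<and> (\<forall>k<p. L A $ k = F k)" using A ..
    fix B assume "B \<in> carrier_tensor n m p \<and> (\<forall>k<p. L B $ k = F k)"
    thus "B = A" using A by (intro L_inject[OF _ A(1) p]) simp_all
  qed
qed

section \<open>The algebra of tensors under the C-product\<close>

lemma c_prod_slices:
  assumes A: "A \<in> carrier_tensor n m p" and B: "B \<in> carrier_tensor m l p" and p: "0 < p"
  shows c_prod_closed: "A *\<^sub>c B \<in> carrier_tensor n l p"
    and L_c_prod: "k < p \<Longrightarrow> L (A *\<^sub>c B) $ k = L A $ k * L B $ k"
proof -
  have "\<exists>!C. C \<in> carrier_tensor n l p \<and> (\<forall>i<p. L C $ i = L A $ i * L B $ i)"
    using A B by (intro L_ex1 p mult_carrier_mat) auto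
  from theI'[OF this]
  have "A *\<^sub>c B \<in> carrier_tensor n l p \<and> (\<forall>i<p. L (A *\<^sub>c B) $ i = L A $ i * L B $ i)"
    unfolding c_prod_def carrier_tensorD(1,2)[OF A p] carrier_tensorD(3)[OF B p] .
  thus "A *\<^sub>c B \<in> carrier_tensor n l p" "k < p \<Longrightarrow> L (A *\<^sub>c B) $ k = L A $ k * L B $ k"
    by auto
qed

lemma dim_mat_adjoint [simp]:
  "dim_row (mat_adjoint A) = dim_col A" "dim_col (mat_adjoint A) = dim_row A"
  by (simp_all add: mat_adjoint_def mat_of_rows_def)

lemma mat_adjoint_closed [simp, intro]:
  "A \<in> carrier_mat n m \<Longrightarrow> mat_adjoint A \<in> carrier_mat m n"
  by (auto simp: mat_adjoint_def mat_of_rows_def)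

lemma mat_adjoint_index:
  "A \<in> carrier_mat n m \<Longrightarrow> i < m \<Longrightarrow> j < n \<Longrightarrow> mat_adjoint A $$ (i, j) = conjugate (A $$ (j, i))"
  by (auto simp: mat_adjoint_def mat_of_rows_index)

lemma mat_adjoint_mult:
  fixes A B :: "complex mat"
  assumes A: "A \<in> carrier_mat n m" and B: "B \<in> carrier_mat m l"
  shows "mat_adjoint (A * B) = mat_adjoint B * mat_adjoint A"
proof (rule eq_matI)
  note AB = mult_carrier_mat[OF A B]
    and adj = mat_adjoint_closed[OF A] mat_adjoint_closed[OF B]
  fix i j
  assume "i < dim_row (mat_adjoint B * mat_adjoint A)" "j < dim_col (mat_adjoint B * mat_adjoint A)"
  hence i: "i < l" and j: "j < n" using adj by auto
  show "mat_adjoint (A * B) $$ (i, j) = (mat_adjoint B * mat_adjoint A) $$ (i, j)"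
    unfolding mat_adjoint_index[OF AB i j] using A B adj i j
    by (simp add: scalar_prod_def mat_adjoint_index[OF A] mat_adjoint_index[OF B] mult.commute)
qed (use mult_carrier_mat[OF A B, THEN mat_adjoint_closed] mat_adjoint_closed[OF A]
  mat_adjoint_closed[OF B] in auto)

lemma mat_adjoint_adjoint:
  fixes A :: "complex mat"
  shows "mat_adjoint (mat_adjoint A) = A"
proof (rule eq_matI)
  have A: "A \<in> carrier_mat (dim_row A) (dim_col A)" by simp
  note adj = mat_adjoint_closed[OF A]
  show "dim_row (mat_adjoint (mat_adjoint A)) = dim_row A"
    "dim_col (mat_adjoint (mat_adjoint A)) = dim_col A"
    by simp_all
  fix i j assume "i < dim_row A" "j < dim_col A"
  thus "mat_adjoint (mat_adjoint A) $$ (i, j) = A $$ (i, j)"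
    by (simp add: mat_adjoint_index[OF adj] mat_adjoint_index[OF A])
qed

lemma c_adjoint_slices:
  assumes A: "A \<in> carrier_tensor n m p" and p: "0 < p"
  shows c_adjoint_closed: "c_adjoint A \<in> carrier_tensor m n p"
    and L_c_adjoint: "k < p \<Longrightarrow> L (c_adjoint A) $ k = mat_adjoint (L A $ k)"
proof -
  have "\<exists>!B. B \<in> carrier_tensor m n p \<and> (\<forall>i<p. L B $ i = mat_adjoint (L A $ i))"
    using A by (intro L_ex1 p mat_adjoint_closed) auto
  from theI'[OF this]
  have "c_adjoint A \<in> carrier_tensor m n p \<and> (\<forall>i<p. L (c_adjoint A) $ i = mat_adjoint (L A $ i))"
    unfolding c_adjoint_def carrier_tensorD(1-3)[OF A p] .
  thus "c_adjoint A \<in> carrier_tensor m n p"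
    "k < p \<Longrightarrow> L (c_adjoint A) $ k = mat_adjoint (L A $ k)" by auto
qed

lemma c_identity_slices:
  assumes p: "0 < p"
  shows c_identity_closed: "c_identity n p \<in> carrier_tensor n n p"
    and L_c_identity: "k < p \<Longrightarrow> L (c_identity n p) $ k = 1\<^sub>m n"
proof -
  have "\<exists>!J. J \<in> carrier_tensor n n p \<and> (\<forall>i<p. L J $ i = 1\<^sub>m n)"
    by (intro L_ex1 p) auto
  from theI'[OF this]
  have "c_identity n p \<in> carrier_tensor n n p \<and> (\<forall>i<p. L (c_identity n p) $ i = 1\<^sub>m n)"
    unfolding c_identity_def .
  thus "c_identity n p \<in> carrier_tensor n n p" "k < p \<Longrightarrow> L (c_identity n p) $ k = 1\<^sub>m n"
    by auto
qed

lemma c_prod_assoc: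
  assumes A: "A \<in> carrier_tensor a b p" and B: "B \<in> carrier_tensor b c p"
    and C: "C \<in> carrier_tensor c d p" and p: "0 < p"
  shows "A *\<^sub>c B *\<^sub>c C = A *\<^sub>c (B *\<^sub>c C)"
proof (rule L_inject[OF _ _ p])
  note AB = c_prod_closed[OF A B p] and BC = c_prod_closed[OF B C p]
  show "A *\<^sub>c B *\<^sub>c C \<in> carrier_tensor a d p" "A *\<^sub>c (B *\<^sub>c C) \<in> carrier_tensor a d p"
    by (intro c_prod_closed[OF AB C p] c_prod_closed[OF A BC p])+
  fix k assume k: "k < p"
  show "L (A *\<^sub>c B *\<^sub>c C) $ k = L (A *\<^sub>c (B *\<^sub>c C)) $ k"
    unfolding L_c_prod[OF AB C p k] L_c_prod[OF A BC p k] L_c_prod[OF A B p k] L_c_prod[OF B C p k]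
    by (rule assoc_mult_mat) (use A B C k in auto)
qed

lemma c_prod_identity_right:
  assumes A: "A \<in> carrier_tensor a b p" and p: "0 < p"
  shows "A *\<^sub>c c_identity b p = A"
proof (rule L_inject[OF _ A p])
  note I = c_identity_closed[OF p, of b]
  show "A *\<^sub>c c_identity b p \<in> carrier_tensor a b p" by (rule c_prod_closed[OF A I p])
  fix k assume k: "k < p"
  show "L (A *\<^sub>c c_identity b p) $ k = L A $ k"
    unfolding L_c_prod[OF A I p k] L_c_identity[OF p k]
    by (rule right_mult_one_mat) (use A k in auto)
qed

lemma c_prod_identity_left:
  assumes A: "A \<in> carrier_tensor a b p" and p: "0 < p"
  shows "c_identity a p *\<^sub>c A = A"
proof (rule L_inject[OF _ A p])
  note I = c_identity_closed[OF p, of a]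
  show "c_identity a p *\<^sub>c A \<in> carrier_tensor a b p" by (rule c_prod_closed[OF I A p])
  fix k assume k: "k < p"
  show "L (c_identity a p *\<^sub>c A) $ k = L A $ k"
    unfolding L_c_prod[OF I A p k] L_c_identity[OF p k]
    by (rule left_mult_one_mat) (use A k in auto)
qed

text \<open>
  Taking adjoints of \<open>X\<^sup>H = G\<^sup>H V\<close> turns the condition on the row spaces into the factorization
  \<open>X = V\<^sup>H G\<close>, which is the form in which uniqueness uses it.
\<close>

lemma c_adjoint_eq_prodD:
  assumes G: "G \<in> carrier_tensor a b p" and V: "V \<in> carrier_tensor a c p"
    and X: "X \<in> carrier_tensor c b p" and p: "0 < p"
    and eq: "c_adjoint X = c_adjoint G *\<^sub>c V"
  shows "X = c_adjoint V *\<^sub>c G"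
proof (rule L_inject[OF X _ p])
  note V' = c_adjoint_closed[OF V p] and G' = c_adjoint_closed[OF G p]
  show "c_adjoint V *\<^sub>c G \<in> carrier_tensor c b p" by (rule c_prod_closed[OF V' G p])
  fix k assume k: "k < p"
  have "mat_adjoint (L X $ k) = mat_adjoint (L G $ k) * L V $ k"
    using arg_cong[OF eq, of "\<lambda>T. L T $ k"]
    unfolding L_c_adjoint[OF X p k] L_c_prod[OF G' V p k] L_c_adjoint[OF G p k] .
  hence "L X $ k = mat_adjoint (mat_adjoint (L G $ k) * L V $ k)"
    by (metis mat_adjoint_adjoint)
  also have "\<dots> = mat_adjoint (L V $ k) * L G $ k"
    by (subst mat_adjoint_mult[of _ b a _ c]) (use G V k in \<open>auto simp: mat_adjoint_adjoint\<close>)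
  also have "\<dots> = L (c_adjoint V *\<^sub>c G) $ k"
    unfolding L_c_prod[OF V' G p k] L_c_adjoint[OF V p k] ..
  finally show "L X $ k = L (c_adjoint V *\<^sub>c G) $ k" .
qed

text \<open>
  Inherited from square matrices over a field, slice by slice. Without it the core computation,
  which produces only a right inverse, would not establish invertibility.
\<close>

lemma c_right_inverse_imp_left_inverse:
  assumes B: "B \<in> carrier_tensor r r p" and C: "C \<in> carrier_tensor r r p" and p: "0 < p"
    and BC: "B *\<^sub>c C = c_identity r p"
  shows "C *\<^sub>c B = c_identity r p"
proof (rule L_inject[OF c_prod_closed[OF C B p] c_identity_closed[OF p] p])
  fix k assume k: "k < p"
  have "L B $ k * L C $ k = 1\<^sub>m r"
    using L_c_prod[OF B C p k] L_c_identity[OF p k] BC by simp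
  hence "L C $ k * L B $ k = 1\<^sub>m r"
    by (intro mat_mult_left_right_inverse[of "L B $ k"]) (use B C k in auto)
  thus "L (C *\<^sub>c B) $ k = L (c_identity r p) $ k"
    unfolding L_c_prod[OF C B p k] L_c_identity[OF p k] .
qed

lemma c_right_inverse_imp_c_inverse:
  assumes B: "B \<in> carrier_tensor r r p" and C: "C \<in> carrier_tensor r r p" and p: "0 < p"
    and BC: "B *\<^sub>c C = c_identity r p"
  shows "c_invertible B" "c_inverse B = C"
proof -
  note d = carrier_tensorD(1,2)[OF B p]
  have CB: "C *\<^sub>c B = c_identity r p" by (rule c_right_inverse_imp_left_inverse[OF B C p BC])
  have inv: "is_c_inverse B C" using B C BC CB by (simp add: is_c_inverse_def d)
  thus "c_invertible B" by (auto simp: c_invertible_def)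
  have "Y = C" if "is_c_inverse B Y" for Y
  proof -
    from that have Y: "Y \<in> carrier_tensor r r p" and BY: "B *\<^sub>c Y = c_identity r p"
      by (auto simp: is_c_inverse_def d)
    have "Y = C *\<^sub>c B *\<^sub>c Y" by (simp add: CB c_prod_identity_left[OF Y p])
    also have "\<dots> = C *\<^sub>c (B *\<^sub>c Y)" by (rule c_prod_assoc[OF C B Y p])
    also have "\<dots> = C" by (simp add: BY c_prod_identity_right[OF C p])
    finally show ?thesis .
  qed
  thus "c_inverse B = C" unfolding c_inverse_def using inv by (intro the_equality)
qed

section \<open>Full rank and cancellation\<close>

text \<open>
  The results on linear independence of columns speak of the \<^emph>\<open>set\<close> of columns and so require the
  columns to be distinct; full column rank provides this, a repeated column leaving fewer than
  \<open>nc\<close> candidates for an independent set.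
\<close>

lemma (in vec_space) full_col_rank_distinct_cols:
  assumes A: "A \<in> carrier_mat n nc" and rank: "rank A = nc"
  shows "distinct (cols A)"
proof -
  obtain S where S: "maximal S (\<lambda>T. T \<subseteq> set (cols A) \<and> lin_indpt T)"
    using maximal_exists_superset[of "set (cols A)" "\<lambda>T. T \<subseteq> set (cols A) \<and> lin_indpt T" "{}"]
      finite_lin_indpt2[of "{}"] by auto
  have "nc = card S" using rank_card_indpt[OF A S] rank by simp
  also have "\<dots> \<le> card (set (cols A))" using S by (auto simp: maximal_def intro: card_mono)
  finally show ?thesis using A card_length[of "cols A"] by (intro card_distinct) auto
qed

text \<open>A matrix with independent columns has trivial kernel, so the columns of \<open>B\<close> and \<open>C\<close> agree.\<close>

lemma (in vec_space) full_col_rank_mult_cancel: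
  assumes A: "A \<in> carrier_mat n nc" and rank: "rank A = nc"
    and B: "B \<in> carrier_mat nc l" and C: "C \<in> carrier_mat nc l" and eq: "A * B = A * C"
  shows "B = C"
proof -
  note dist = full_col_rank_distinct_cols[OF A rank]
  have "col B j = col C j" if j: "j < l" for j
  proof -
    have cB: "col B j \<in> carrier_vec nc" and cC: "col C j \<in> carrier_vec nc"
      using B C j by auto
    have "A *\<^sub>v (col B j - col C j) = A *\<^sub>v col B j - A *\<^sub>v col C j"
      by (rule mult_minus_distrib_mat_vec[OF A cB cC])
    also have "\<dots> = 0\<^sub>v n"
      using A arg_cong[OF eq, of "\<lambda>X. col X j"]
      unfolding col_mult2[OF A B j] col_mult2[OF A C j] by auto
    finally have "col B j - col C j = 0\<^sub>v nc"
      using lin_depI[OF A _ _ _ dist, of "col B j - col C j"] full_rank_lin_indpt[OF A rank dist]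
        cB cC by auto
    hence diff: "(col B j - col C j) $ i = 0" if "i < nc" for i
      using that by simp
    show ?thesis
    proof (rule eq_vecI)
      fix i assume "i < dim_vec (col C j)"
      hence "i < nc" using C by simp
      thus "col B j $ i = col C j $ i" using diff[of i] B C j by simp
    qed (use B C in simp)
  qed
  thus ?thesis using B C by (intro mat_col_eqI) auto
qed

text \<open>
  A maximal independent set of columns has \<open>n\<close> elements and hence is a basis, so every unit vector
  has a preimage under \<open>A\<close>. These preimages are the columns of a right inverse.
\<close>

lemma (in vec_space) full_row_rank_right_inverse:
  assumes A: "A \<in> carrier_mat n nc" and rank: "rank A = n"
  obtains R where "R \<in> carrier_mat nc n" "A * R = 1\<^sub>m n"
proof -
  obtain S where S: "maximal S (\<lambda>T. T \<subseteq> set (cols A) \<and> lin_indpt T)"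
    using maximal_exists_superset[of "set (cols A)" "\<lambda>T. T \<subseteq> set (cols A) \<and> lin_indpt T" "{}"]
      finite_lin_indpt2[of "{}"] by auto
  have SA: "S \<subseteq> set (cols A)" and li: "lin_indpt S" using S by (auto simp: maximal_def)
  have Sc: "S \<subseteq> carrier_vec n" using SA A cols_dim by blast
  have "card S = dim" using rank_card_indpt[OF A S] rank dim_is_n by metis
  hence "basis S"
    using SA Sc li by (intro dim_li_is_basis) (auto intro: finite_subset)
  hence "carrier_vec n \<subseteq> col_space A"
    using span_is_monotone[OF SA] by (auto simp: basis_def col_space_def)
  hence "\<exists>x. x \<in> carrier_vec nc \<and> A *\<^sub>v x = y" if "y \<in> carrier_vec n" for y
    using that A unfolding col_space_eq[OF A] by auto
  hence "\<forall>j. \<exists>x. x \<in> carrier_vec nc \<and> A *\<^sub>v x = unit_vec n j"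
    by simp
  then obtain x where x: "\<And>j. x j \<in> carrier_vec nc" "\<And>j. A *\<^sub>v x j = unit_vec n j"
    by metis
  define R where "R = mat_of_cols nc (map x [0..<n])"
  have R: "R \<in> carrier_mat nc n" unfolding R_def by (rule carrier_matI) simp_all
  have "A * R = 1\<^sub>m n"
  proof (rule mat_col_eqI)
    fix j assume "j < dim_col (1\<^sub>m n)"
    hence j: "j < n" by simp
    have "col R j = x j" using j x by (simp add: R_def)
    thus "col (A * R) j = col (1\<^sub>m n) j" unfolding col_mult2[OF A R j] using j x by simp
  qed (use A R in auto)
  thus ?thesis using R that by blast
qed

lemma c_prod_left_cancel:
  assumes M: "M \<in> carrier_tensor n r p" and p: "0 < p"
    and rank: "\<And>k. k < p \<Longrightarrow> vec_space.rank n (L M $ k) = r"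
    and B: "B \<in> carrier_tensor r l p" and C: "C \<in> carrier_tensor r l p"
    and eq: "M *\<^sub>c B = M *\<^sub>c C"
  shows "B = C"
proof (rule L_inject[OF B C p])
  fix k assume k: "k < p"
  have "L M $ k * L B $ k = L M $ k * L C $ k"
    using L_c_prod[OF M B p k] L_c_prod[OF M C p k] eq by simp
  thus "L B $ k = L C $ k"
    by (rule vec_space.full_col_rank_mult_cancel[OF L_slice_closed[OF M k] rank[OF k]
          L_slice_closed[OF B k] L_slice_closed[OF C k]])
qed

lemma c_right_inverse_exists:
  assumes N: "N \<in> carrier_tensor r m p" and p: "0 < p"
    and rank: "\<And>k. k < p \<Longrightarrow> vec_space.rank r (L N $ k) = r"
  obtains R where "R \<in> carrier_tensor m r p" "N *\<^sub>c R = c_identity r p"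
proof -
  have "\<exists>R. R \<in> carrier_mat m r \<and> L N $ k * R = 1\<^sub>m r" if k: "k < p" for k
    using vec_space.full_row_rank_right_inverse[OF L_slice_closed[OF N k] rank[OF k]] by metis
  then obtain F where F: "\<And>k. k < p \<Longrightarrow> F k \<in> carrier_mat m r"
    "\<And>k. k < p \<Longrightarrow> L N $ k * F k = 1\<^sub>m r" by metis
  obtain R where R: "R \<in> carrier_tensor m r p" "\<forall>k<p. L R $ k = F k"
    using L_surj[of p F m r, OF p F(1)] by blast
  have "N *\<^sub>c R = c_identity r p"
    by (rule L_inject[OF c_prod_closed[OF N R(1) p] c_identity_closed[OF p] p])
      (simp add: L_c_prod[OF N R(1) p] L_c_identity[OF p] R(2) F(2))
  thus ?thesis using that R(1) by blast
qed

section \<open>The inverse along a tensor\<close>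

text \<open>
  Both inverses equal \<open>Y A X\<close>: with \<open>X = G U\<close> and \<open>Y A G = G\<close> it is \<open>G U = X\<close>, and with
  \<open>Y = V\<^sup>H G\<close> and \<open>G A X = G\<close> it is \<open>V\<^sup>H G = Y\<close>.
\<close>

lemma is_inverse_along_unique:
  assumes A: "A \<in> carrier_tensor n1 n2 p" and G: "G \<in> carrier_tensor n2 n1 p" and p: "0 < p"
    and X: "is_inverse_along A G X" and Y: "is_inverse_along A G Y"
  shows "X = Y"
proof -
  note d = carrier_tensorD(1-3)[OF A p]
  obtain U where Xc: "X \<in> carrier_tensor n2 n1 p" and U: "U \<in> carrier_tensor n1 n1 p"
    and GAX: "G *\<^sub>c A *\<^sub>c X = G" and XU: "X = G *\<^sub>c U"
    using X by (auto simp: is_inverse_along_def d)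
  obtain V where Yc: "Y \<in> carrier_tensor n2 n1 p" and V: "V \<in> carrier_tensor n2 n2 p"
    and YAG: "Y *\<^sub>c A *\<^sub>c G = G" and YV: "c_adjoint Y = c_adjoint G *\<^sub>c V"
    using Y by (auto simp: is_inverse_along_def d)
  note V' = c_adjoint_closed[OF V p]
  have YG: "Y = c_adjoint V *\<^sub>c G" by (rule c_adjoint_eq_prodD[OF G V Yc p YV])
  have "X = Y *\<^sub>c A *\<^sub>c G *\<^sub>c U" using YAG XU by simp
  also have "\<dots> = Y *\<^sub>c A *\<^sub>c X"
    unfolding XU by (rule c_prod_assoc[OF c_prod_closed[OF Yc A p] G U p])
  also have "\<dots> = c_adjoint V *\<^sub>c (G *\<^sub>c A *\<^sub>c X)"
    unfolding YG c_prod_assoc[OF V' G A p]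
    by (rule c_prod_assoc[OF V' c_prod_closed[OF G A p] Xc p])
  also have "\<dots> = Y" using GAX YG by simp
  finally show ?thesis .
qed

theorem theorem5p3:
  fixes n1 n2 n3 :: nat and A G M N :: tensor
  assumes "0 < n3"
    and "A \<in> carrier_tensor n1 n2 n3"
    and "G \<in> carrier_tensor n2 n1 n3"
    and "c_full_rank_decomposition G M N"
    and "invertible_along A G"
  shows "c_invertible (N *\<^sub>c A *\<^sub>c M) \<and>
    inverse_along A G = M *\<^sub>c c_inverse (N *\<^sub>c A *\<^sub>c M) *\<^sub>c N"
proof -
  note p = assms(1) and A = assms(2) and G = assms(3)
  note dA = carrier_tensorD(1-3)[OF A p] and dG = carrier_tensorD(1-3)[OF G p]
  obtain r where GMN: "G = M *\<^sub>c N"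
    and M: "M \<in> carrier_tensor n2 r n3" and N: "N \<in> carrier_tensor r n1 n3"
    and rankM: "\<And>k. k < n3 \<Longrightarrow> vec_space.rank n2 (L M $ k) = r"
    and rankN: "\<And>k. k < n3 \<Longrightarrow> vec_space.rank r (L N $ k) = r"
    using assms(4) by (auto simp: c_full_rank_decomposition_def dG)
  obtain X where X: "is_inverse_along A G X" using assms(5) by (auto simp: invertible_along_def)
  then obtain U where U: "U \<in> carrier_tensor n1 n1 n3"
    and GAX: "G *\<^sub>c A *\<^sub>c X = G" and XU: "X = G *\<^sub>c U"
    by (auto simp: is_inverse_along_def dA)
  obtain R where R: "R \<in> carrier_tensor n1 r n3" and NR: "N *\<^sub>c R = c_identity r n3"
    using c_right_inverse_exists[OF N p rankN] .
  define T where "T = N *\<^sub>c A *\<^sub>c M"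
  define C where "C = N *\<^sub>c U *\<^sub>c R"
  note NA = c_prod_closed[OF N A p] and NU = c_prod_closed[OF N U p]
  have T: "T \<in> carrier_tensor r r n3" unfolding T_def by (rule c_prod_closed[OF NA M p])
  have C: "C \<in> carrier_tensor r r n3" unfolding C_def by (rule c_prod_closed[OF NU R p])
  note TNU = c_prod_closed[OF T NU p]
  have XM: "X = M *\<^sub>c (N *\<^sub>c U)" unfolding XU GMN by (rule c_prod_assoc[OF M N U p])
  have "M *\<^sub>c (T *\<^sub>c (N *\<^sub>c U)) = M *\<^sub>c (N *\<^sub>c A *\<^sub>c X)"
    unfolding T_def XM by (simp only: c_prod_assoc[OF NA M NU p])
  also have "\<dots> = G *\<^sub>c A *\<^sub>c X"
    unfolding XM GMN
    by (simp only: c_prod_assoc[OF M N A p] c_prod_assoc[OF M NA c_prod_closed[OF M NU p] p])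
  also have "\<dots> = M *\<^sub>c N" using GAX GMN by simp
  finally have M_TNU: "M *\<^sub>c (T *\<^sub>c (N *\<^sub>c U)) = M *\<^sub>c N" .
  have TNU_N: "T *\<^sub>c (N *\<^sub>c U) = N"
    by (rule c_prod_left_cancel[OF M p _ TNU N M_TNU]) (rule rankM)
  have TC: "T *\<^sub>c C = c_identity r n3"
    unfolding C_def by (simp only: c_prod_assoc[OF T NU R p, symmetric] TNU_N NR)
  note inv = c_right_inverse_imp_c_inverse[OF T C p TC]
  have "C *\<^sub>c N = C *\<^sub>c (T *\<^sub>c (N *\<^sub>c U))" by (simp only: TNU_N)
  also have "\<dots> = C *\<^sub>c T *\<^sub>c (N *\<^sub>c U)" by (rule c_prod_assoc[OF C T NU p, symmetric])
  also have "\<dots> = N *\<^sub>c U"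
    by (simp only: c_right_inverse_imp_left_inverse[OF T C p TC] c_prod_identity_left[OF NU p])
  finally have "X = M *\<^sub>c c_inverse T *\<^sub>c N"
    unfolding XM inv(2) by (simp only: c_prod_assoc[OF M C N p])
  moreover have "inverse_along A G = X"
    unfolding inverse_along_def by (intro the_equality X is_inverse_along_unique[OF A G p _ X])
  ultimately show ?thesis using inv(1) unfolding T_def by simp
qed

end
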